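(* Let $\mathcal U^N=\{u^i\}_{i=1}^N\subset\mathcal U$ be a finite data set, and fix $\theta=(\theta_u,\theta_v)$, $\tau>0$ and encoders $\bar g_u(\cdot;\theta_u):\mathcal U\to\mathbb S^{n_e-1}$, $\bar g_v(\cdot;\theta_v):\mathcal V\to\mathbb S^{n_e-1}$. For each $v\in\mathcal V$, crossmodal retrieval with $K=1$, which computes an index $$i^\ast\in\arg\max_{i=1,\dots,N}\ \langle\bar g_u(u^i;\theta_u),\bar g_v(v;\theta_v)\rangle$$ and outputs $u^{i^\ast}$, finds a mode of the empirical conditional distribution $\nu^N_{u|v}(\cdot|v;\theta)$ defined in the context.
   Context: $\mathbb S^{n_e-1}$ is the Euclidean unit sphere in $\mathbb R^{n_e}$ and $\langle\cdot,\cdot\rangle$ the Euclidean inner product. Crossmodal retrieval: given $v\in\mathcal V$, the data $\mathcal U^N$ and an integer $K$, compute the cosine similarities $s_i=\langle\bar g_u(u^i;\theta_u),\bar g_v(v;\theta_v)\rangle$, and output the samples corresponding to $K$ distinct indices with the largest similarities. Let $\mu_u^N=\frac1N\sum_{i=1}^N\delta_{u^i}$. The empirical conditional distribution is the probability measure $$\nu^N_{u|v}(du|v;\theta)\propto\exp\bigl(\langle\bar g_u(u;\theta_u),\bar g_v(v;\theta_v)\rangle/\tau\bigr)\mu_u^N(du),$$ that is, $\nu^N_{u|v}(\cdot|v;\theta)=\sum_{i=1}^N w_i\delta_{u^i}$ with $w_i=\omega_i/\sum_{\ell=1}^N\omega_\ell$ and $\omega_i=\exp(\langle\bar g_u(u^i;\theta_u),\bar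 g_v(v;\theta_v)\rangle/\tau)$. A mode of $\nu^N_{u|v}(\cdot|v;\theta)$ is a point of $\mathcal U^N$ that maximizes, over $\mathcal U^N$, the density of $\nu^N_{u|v}(\cdot|v;\theta)$ with respect to the empirical measure $\mu_u^N$. *)

theory Defs
  imports "HOL-Probability.Probability"
begin

text \<open>The measure \<open>\<Sum>i\<in>I. w i \<cdot> \<delta>\<^bsub>x i\<^esub>\<close> on the measurable space underlying \<open>M\<close>
  (only \<open>space M\<close> and \<open>sets M\<close> matter). Points \<open>x i\<close> may coincide.\<close>

definition dirac_sum :: "'a measure \<Rightarrow> 'i set \<Rightarrow> ('i \<Rightarrow> real) \<Rightarrow> ('i \<Rightarrow> 'a) \<Rightarrow> 'a measure" where
  "dirac_sum M I w x =
     measure_of (space M) (sets M) (\<lambda>A. \<Sum>i\<in>I. ennreal (w i) * emeasure (return M (x i)) A)"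

text \<open>The encoders take the sample and their parameter; they are normalised (sphere-valued) by
  hypothesis, so the cosine similarity is the plain inner product.\<close>

definition similarity ::
  "('u \<Rightarrow> 'p \<Rightarrow> real ^ 'n) \<Rightarrow> ('v \<Rightarrow> 'q \<Rightarrow> real ^ 'n) \<Rightarrow> 'p \<times> 'q \<Rightarrow> 'u \<Rightarrow> 'v \<Rightarrow> real" where
  "similarity gu gv \<theta> u v = gu u (fst \<theta>) \<bullet> gv v (snd \<theta>)"

text \<open>Retrieval need not be deterministic because of ties: the predicate says that \<open>I\<close> is an
  admissible set of \<open>K\<close> distinct indices, the output being the samples \<open>x i\<close> for \<open>i \<in> I\<close>.\<close>

definition crossmodal_retrieval ::
  "('u \<Rightarrow> 'p \<Rightarrow> real ^ 'n) \<Rightarrow> ('v \<Rightarrow> 'q \<Rightarrow> real ^ 'n) \<Rightarrow> 'p \<times> 'q \<Rightarrow>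
   (nat \<Rightarrow> 'u) \<Rightarrow> nat \<Rightarrow> 'v \<Rightarrow> nat \<Rightarrow> nat set \<Rightarrow> bool" where
  "crossmodal_retrieval gu gv \<theta> x N v K I \<longleftrightarrow>
     I \<subseteq> {1..N} \<and> card I = K \<and>
     (\<forall>i\<in>I. \<forall>j\<in>{1..N} - I. similarity gu gv \<theta> (x j) v \<le> similarity gu gv \<theta> (x i) v)"

definition empirical_measure :: "'u measure \<Rightarrow> (nat \<Rightarrow> 'u) \<Rightarrow> nat \<Rightarrow> 'u measure" where
  "empirical_measure M x N = dirac_sum M {1..N} (\<lambda>_. 1 / real N) x"

definition unnormalized_weight ::
  "('u \<Rightarrow> 'p \<Rightarrow> real ^ 'n) \<Rightarrow> ('v \<Rightarrow> 'q \<Rightarrow> real ^ 'n) \<Rightarrow> 'p \<times> 'q \<Rightarrow> real \<Rightarrow> 'u \<Rightarrow> 'v \<Rightarrow> real" where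
  "unnormalized_weight gu gv \<theta> \<tau> u v = exp (similarity gu gv \<theta> u v / \<tau>)"

definition empirical_conditional ::
  "'u measure \<Rightarrow> ('u \<Rightarrow> 'p \<Rightarrow> real ^ 'n) \<Rightarrow> ('v \<Rightarrow> 'q \<Rightarrow> real ^ 'n) \<Rightarrow> 'p \<times> 'q \<Rightarrow> real \<Rightarrow>
   (nat \<Rightarrow> 'u) \<Rightarrow> nat \<Rightarrow> 'v \<Rightarrow> 'u measure" where
  "empirical_conditional M gu gv \<theta> \<tau> x N v =
     dirac_sum M {1..N}
       (\<lambda>i. unnormalized_weight gu gv \<theta> \<tau> (x i) v /
            (\<Sum>l=1..N. unnormalized_weight gu gv \<theta> \<tau> (x l) v)) x"

text \<open>A mode of \<open>\<nu>\<close> on \<open>S\<close> relative to \<open>\<mu>\<close> maximises the Radon-Nikodym derivative of \<open>\<nu>\<close> with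
  respect to \<open>\<mu>\<close> over \<open>S\<close>. Pointwise values of \<open>RN_deriv\<close> are meaningful at the atoms of \<open>\<mu>\<close>.
  The existence of the derivative in the case of interest is shown in
  \<open>density_RN_deriv_empirical_conditional\<close> below.\<close>

definition is_mode :: "'a measure \<Rightarrow> 'a measure \<Rightarrow> 'a set \<Rightarrow> 'a \<Rightarrow> bool" where
  "is_mode \<mu> \<nu> S a \<longleftrightarrow> is_arg_max (RN_deriv \<mu> \<nu>) (\<lambda>b. b \<in> S) a"

lemma dirac_sum_eq_distr:
  assumes "finite I" "\<And>i. i \<in> I \<Longrightarrow> x i \<in> space M"
  shows "dirac_sum M I w x = distr (point_measure I (\<lambda>i. ennreal (w i))) M x"
proof -
  have m: "x \<in> measurable (point_measure I (\<lambda>i. ennreal (w i))) M"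
    using assms by (simp add: Pi_iff)
  have eq: "(\<Sum>i\<in>I. ennreal (w i) * emeasure (return M (x i)) A) =
      emeasure (point_measure I (\<lambda>i. ennreal (w i)))
        (x -` A \<inter> space (point_measure I (\<lambda>i. ennreal (w i))))" if A: "A \<in> sets M" for A
  proof -
    have "(\<Sum>i\<in>I. ennreal (w i) * emeasure (return M (x i)) A) =
        (\<Sum>i\<in>I. if i \<in> x -` A \<inter> I then ennreal (w i) else 0)"
      using A by (intro sum.cong) (auto simp: indicator_def)
    also have "\<dots> = (\<Sum>i\<in>x -` A \<inter> I. ennreal (w i))"
      using assms(1) by (subst Int_commute) (simp add: sum.inter_restrict)
    also have "\<dots> = emeasure (point_measure I (\<lambda>i. ennreal (w i))) (x -` A \<inter> I)"
      using assms(1) by (subst emeasure_point_measure_finite) auto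
    finally show ?thesis by (simp add: space_point_measure)
  qed
  show ?thesis
    unfolding dirac_sum_def distr_def
    by (rule measure_of_eq) (use sets.space_closed eq in \<open>auto simp: sets.sigma_sets_eq\<close>)
qed

lemma space_dirac_sum [simp]: "space (dirac_sum M I w x) = space M"
  by (simp add: dirac_sum_def)

lemma sets_dirac_sum [simp, measurable_cong]: "sets (dirac_sum M I w x) = sets M"
  by (simp add: dirac_sum_def)

lemma nn_integral_dirac_sum:
  assumes "finite I" "\<And>i. i \<in> I \<Longrightarrow> x i \<in> space M" "f \<in> borel_measurable M"
  shows "(\<integral>\<^sup>+a. f a \<partial>dirac_sum M I w x) = (\<Sum>i\<in>I. ennreal (w i) * f (x i))"
  using assms
  by (simp add: dirac_sum_eq_distr nn_integral_distr Pi_iff nn_integral_point_measure_finite)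

lemma emeasure_dirac_sum:
  assumes "finite I" "\<And>i. i \<in> I \<Longrightarrow> x i \<in> space M" "A \<in> sets M"
  shows "emeasure (dirac_sum M I w x) A = (\<Sum>i\<in>I. ennreal (w i) * indicator A (x i))"
  using nn_integral_dirac_sum[OF assms(1,2), where f = "indicator A" and w = w] assms(3) by simp

lemma density_dirac_sum:
  assumes "finite I" "\<And>i. i \<in> I \<Longrightarrow> x i \<in> space M" "f \<in> borel_measurable M"
    and "\<And>i. i \<in> I \<Longrightarrow> ennreal (w' i) = ennreal (w i) * f (x i)"
  shows "density (dirac_sum M I w x) f = dirac_sum M I w' x"
proof (rule measure_eqI)
  fix A assume "A \<in> sets (density (dirac_sum M I w x) f)"
  then have A: "A \<in> sets M" by simp
  have "emeasure (density (dirac_sum M I w x) f) A = (\<integral>\<^sup>+a. f a * indicator A a \<partial>dirac_sum M I w x)"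
    using A assms(3) by (subst emeasure_density) auto
  also have "\<dots> = (\<Sum>i\<in>I. ennreal (w i) * (f (x i) * indicator A (x i)))"
    using A assms by (subst nn_integral_dirac_sum) auto
  also have "\<dots> = emeasure (dirac_sum M I w' x) A"
    using A assms by (simp add: emeasure_dirac_sum mult.assoc)
  finally show "emeasure (density (dirac_sum M I w x) f) A = emeasure (dirac_sum M I w' x) A" .
qed simp

lemma prob_space_dirac_sum:
  assumes "finite I" "\<And>i. i \<in> I \<Longrightarrow> x i \<in> space M" "\<And>i. i \<in> I \<Longrightarrow> 0 \<le> w i" "(\<Sum>i\<in>I. w i) = 1"
  shows "prob_space (dirac_sum M I w x)"
  using assms by (intro prob_spaceI) (simp add: emeasure_dirac_sum sum_ennreal)

lemma sum_unnormalized_weight_pos: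
  "(N::nat) \<ge> 1 \<Longrightarrow> 0 < (\<Sum>l=1..N. unnormalized_weight gu gv \<theta> \<tau> (x l) v)"
  by (rule sum_pos) (simp_all add: unnormalized_weight_def)

lemma prob_space_empirical_conditional:
  assumes "N \<ge> 1" "\<And>i. i \<in> {1..N} \<Longrightarrow> x i \<in> space M"
  shows "prob_space (empirical_conditional M gu gv \<theta> \<tau> x N v)"
  unfolding empirical_conditional_def
  using assms sum_unnormalized_weight_pos[OF assms(1), of gu gv \<theta> \<tau> x v]
  by (intro prob_space_dirac_sum)
     (auto simp: sum_divide_distrib[symmetric] unnormalized_weight_def intro!: divide_nonneg_nonneg sum_nonneg)

text \<open>The description of the empirical conditional distribution as a tilted empirical measure,
  when the encoder is measurable.\<close>

lemma empirical_conditional_eq_density: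
  assumes "N \<ge> 1" "\<And>i. i \<in> {1..N} \<Longrightarrow> x i \<in> space M"
    and [measurable]: "(\<lambda>u. gu u (fst \<theta>)) \<in> borel_measurable M"
  shows "empirical_conditional M gu gv \<theta> \<tau> x N v =
    density (empirical_measure M x N)
      (\<lambda>u. ennreal (real N / (\<Sum>l=1..N. unnormalized_weight gu gv \<theta> \<tau> (x l) v)
                    * exp (similarity gu gv \<theta> u v / \<tau>)))"
  unfolding empirical_conditional_def empirical_measure_def
proof (rule density_dirac_sum[symmetric])
  show "(\<lambda>u. ennreal (real N / (\<Sum>l=1..N. unnormalized_weight gu gv \<theta> \<tau> (x l) v)
      * exp (similarity gu gv \<theta> u v / \<tau>))) \<in> borel_measurable M"
    unfolding similarity_def by measurable
qed (use assms sum_unnormalized_weight_pos[OF assms(1), of gu gv \<theta> \<tau> x v] in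
     \<open>auto simp: ennreal_mult'[symmetric] unnormalized_weight_def\<close>)

lemma density_RN_deriv_empirical_conditional:
  assumes "N \<ge> 1" "\<And>i. i \<in> {1..N} \<Longrightarrow> x i \<in> space M"
    and sing: "\<And>i. i \<in> {1..N} \<Longrightarrow> {x i} \<in> sets M"
  shows "density (empirical_measure M x N)
      (RN_deriv (empirical_measure M x N) (empirical_conditional M gu gv \<theta> \<tau> x N v))
    = empirical_conditional M gu gv \<theta> \<tau> x N v"
proof -
  define Z where "Z = (\<Sum>l=1..N. unnormalized_weight gu gv \<theta> \<tau> (x l) v)"
  have Z: "0 < Z" unfolding Z_def by (rule sum_unnormalized_weight_pos[OF assms(1)])
  define g where "g b = ennreal (real N * (unnormalized_weight gu gv \<theta> \<tau> b v / Z))" for b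
  define f where "f a = (\<Sum>b\<in>x ` {1..N}. g b * indicator {b} a)" for a
  have f: "f (x i) = g (x i)" if "i \<in> {1..N}" for i
  proof -
    have "f (x i) = (\<Sum>b\<in>x ` {1..N}. if b = x i then g b else 0)"
      unfolding f_def by (intro sum.cong) (auto simp: indicator_def)
    then show ?thesis using that by (simp add: sum.delta)
  qed
  have fm: "f \<in> borel_measurable M"
    unfolding f_def using sing by (intro borel_measurable_sum borel_measurable_times) auto
  have "density (empirical_measure M x N) f = empirical_conditional M gu gv \<theta> \<tau> x N v"
    unfolding empirical_measure_def empirical_conditional_def Z_def[symmetric]
    by (rule density_dirac_sum)
       (use assms fm Z in \<open>auto simp: f g_def ennreal_mult'[symmetric] unnormalized_weight_def\<close>)
  moreover have "f \<in> borel_measurable (empirical_measure M x N)"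
    using fm by (simp add: empirical_measure_def measurable_cong_sets[OF sets_dirac_sum refl])
  ultimately show ?thesis by (blast intro: RN_derivI)
qed

end

theory Submission
  imports Defs
begin

text \<open>Each data point is an atom of the empirical measure, so the Radon-Nikodym derivative is
  determined there, repeated points contributing the same factor to both measures: at \<open>x i\<close> it
  is \<open>N\<close> times the softmax weight of \<open>x i\<close>. This is a strictly increasing function of the
  similarity, hence maximising similarity over the indices maximises the density over the data.\<close>

text \<open>Under the indicator of the singleton, the integrand can be replaced by its constant
  value \<open>f a\<close>.\<close>

lemma emeasure_density_singleton:
  assumes "f \<in> borel_measurable M" "{a} \<in> sets M"
  shows "emeasure (density M f) {a} = f a * emeasure M {a}"
proof -
  have "emeasure (density M f) {a} = (\<integral>\<^sup>+b. f b * indicator {a} b \<partial>M)"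
    using assms by (rule emeasure_density)
  also have "\<dots> = (\<integral>\<^sup>+b. f a * indicator {a} b \<partial>M)"
    by (rule nn_integral_cong) (simp add: indicator_def)
  finally show ?thesis
    using assms(2) by (simp add: nn_integral_cmult_indicator)
qed

text \<open>In general a Radon-Nikodym derivative is fixed only almost everywhere. At an atom of
  finite positive mass its value is forced to be the ratio of the two masses, so pointwise claims
  about \<open>RN_deriv\<close> make sense there.\<close>

lemma RN_deriv_atom:
  assumes dens: "density M (RN_deriv M N) = N" and a: "{a} \<in> sets M"
    and "emeasure M {a} \<noteq> 0" "emeasure M {a} \<noteq> \<infinity>"
    and eq: "emeasure N {a} = c * emeasure M {a}"
  shows "RN_deriv M N a = c"
proof -
  have "RN_deriv M N a * emeasure M {a} = c * emeasure M {a}"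
    using emeasure_density_singleton[OF borel_measurable_RN_deriv a, of N] dens eq by simp
  \<comment> \<open>Cancelling in the extended nonnegative reals needs a factor that is neither zero
    nor infinite.\<close>
  then show ?thesis
    using assms(3,4) by (simp add: mult.commute[of _ "emeasure M {a}"] ennreal_mult_cancel_left)
qed

lemma RN_deriv_empirical_conditional:
  assumes N: "N \<ge> 1" and sp: "\<And>i. i \<in> {1..N} \<Longrightarrow> x i \<in> space M"
    and sing: "\<And>i. i \<in> {1..N} \<Longrightarrow> {x i} \<in> sets M"
    and i: "i \<in> {1..N}"
  shows "RN_deriv (empirical_measure M x N) (empirical_conditional M gu gv \<theta> \<tau> x N v) (x i) =
    ennreal (real N * (unnormalized_weight gu gv \<theta> \<tau> (x i) v /
      (\<Sum>l=1..N. unnormalized_weight gu gv \<theta> \<tau> (x l) v)))"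
proof (rule RN_deriv_atom)
  define Z where "Z = (\<Sum>l=1..N. unnormalized_weight gu gv \<theta> \<tau> (x l) v)"
  have Z: "0 < Z"
    unfolding Z_def by (rule sum_unnormalized_weight_pos[OF N])
  have \<mu>: "emeasure (empirical_measure M x N) {x i} =
      (\<Sum>j=1..N. ennreal (1 / real N) * indicator {x i} (x j))"
    unfolding empirical_measure_def using sp sing[OF i] by (intro emeasure_dirac_sum) auto
  show "density (empirical_measure M x N)
      (RN_deriv (empirical_measure M x N) (empirical_conditional M gu gv \<theta> \<tau> x N v)) =
      empirical_conditional M gu gv \<theta> \<tau> x N v"
    by (rule density_RN_deriv_empirical_conditional[OF N sp sing])
  show "{x i} \<in> sets (empirical_measure M x N)"
    using sing[OF i] by (simp add: empirical_measure_def)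
  \<comment> \<open>The summand with \<open>j = i\<close> already contributes
    \<open>1 / real N\<close>.\<close>
  show "emeasure (empirical_measure M x N) {x i} \<noteq> 0"
    unfolding \<mu> using i by (subst sum_eq_0_iff) (auto intro!: bexI[of _ i])
  show "emeasure (empirical_measure M x N) {x i} \<noteq> \<infinity>"
    unfolding \<mu> by (auto simp: indicator_def ennreal_mult_eq_top_iff)
  have "emeasure (empirical_conditional M gu gv \<theta> \<tau> x N v) {x i} =
      (\<Sum>j=1..N. ennreal (unnormalized_weight gu gv \<theta> \<tau> (x j) v / Z) * indicator {x i} (x j))"
    unfolding empirical_conditional_def Z_def[symmetric]
    using sp sing[OF i] by (intro emeasure_dirac_sum) auto
  \<comment> \<open>The equality holds term by term. If \<open>x j = x i\<close>, the two
    unnormalized weights agree, since they depend on the sample and not on its index, and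
    \<open>real N\<close> cancels \<open>1 / real N\<close>; otherwise both terms vanish. This
    covers repeated data points.\<close>
  also have "\<dots> = (\<Sum>j=1..N. ennreal (real N * (unnormalized_weight gu gv \<theta> \<tau> (x i) v / Z)) *
      (ennreal (1 / real N) * indicator {x i} (x j)))"
    using N Z
    by (intro sum.cong) (auto simp: indicator_def ennreal_mult'[symmetric] unnormalized_weight_def)
  finally show "emeasure (empirical_conditional M gu gv \<theta> \<tau> x N v) {x i} =
      ennreal (real N * (unnormalized_weight gu gv \<theta> \<tau> (x i) v / Z)) *
        emeasure (empirical_measure M x N) {x i}"
    unfolding \<mu> by (simp only: sum_distrib_left)
qed

text \<open>Retrieval compares a chosen index only with those outside \<open>I\<close>. For a
  singleton the one missing comparison is that of \<open>i\<close> with itself, which is trivial.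
  Ties leave several admissible \<open>i\<close>.\<close>

lemma crossmodal_retrieval_1_iff:
  "crossmodal_retrieval gu gv \<theta> x N v 1 I \<longleftrightarrow>
    (\<exists>i. I = {i} \<and> is_arg_max (\<lambda>i. similarity gu gv \<theta> (x i) v) (\<lambda>i. i \<in> {1..N}) i)" (is "?L \<longleftrightarrow> ?R")
proof
  assume ?L
  then obtain i where "I = {i}"
    unfolding crossmodal_retrieval_def by (blast elim: card_1_singletonE)
  with \<open>?L\<close> show ?R
    unfolding crossmodal_retrieval_def is_arg_max_linorder by blast
next
  assume ?R
  then show ?L
    by (auto simp: crossmodal_retrieval_def is_arg_max_linorder)
qed

text \<open>Finitely many similarities, at least one of them, attain their maximum; thus the claim
  about retrieved samples is not vacuous.\<close>

lemma crossmodal_retrieval_1_exists: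
  assumes "N \<ge> 1"
  shows "\<exists>I. crossmodal_retrieval gu gv \<theta> x N v 1 I"
proof -
  have "Max ((\<lambda>i. similarity gu gv \<theta> (x i) v) ` {1..N}) \<in> (\<lambda>i. similarity gu gv \<theta> (x i) v) ` {1..N}"
    using assms by (intro Max_in) auto
  then obtain i where "i \<in> {1..N}"
    and "Max ((\<lambda>i. similarity gu gv \<theta> (x i) v) ` {1..N}) = similarity gu gv \<theta> (x i) v"
    by blast
  then have "is_arg_max (\<lambda>i. similarity gu gv \<theta> (x i) v) (\<lambda>i. i \<in> {1..N}) i"
    unfolding is_arg_max_linorder by (metis Max_ge finite_atLeastAtMost finite_imageI imageI)
  then show ?thesis
    unfolding crossmodal_retrieval_1_iff by blast
qed

lemma is_arg_max_similarity_imp_is_mode: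
  assumes N: "N \<ge> 1" and sp: "\<And>i. i \<in> {1..N} \<Longrightarrow> x i \<in> space M"
    and sing: "\<And>i. i \<in> {1..N} \<Longrightarrow> {x i} \<in> sets M" and "\<tau> > 0"
    and max: "is_arg_max (\<lambda>i. similarity gu gv \<theta> (x i) v) (\<lambda>i. i \<in> {1..N}) i"
  shows "is_mode (empirical_measure M x N) (empirical_conditional M gu gv \<theta> \<tau> x N v)
    (x ` {1..N}) (x i)"
proof -
  have i: "i \<in> {1..N}"
    using max by (simp add: is_arg_max_linorder)
  have le: "similarity gu gv \<theta> (x j) v \<le> similarity gu gv \<theta> (x i) v" if "j \<in> {1..N}" for j
    using max that by (auto simp: is_arg_max_linorder)
  \<comment> \<open>Dividing by a positive \<open>\<tau>\<close> and exponentiating both preserve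
    order.\<close>
  have weight_le: "unnormalized_weight gu gv \<theta> \<tau> (x j) v \<le> unnormalized_weight gu gv \<theta> \<tau> (x i) v"
    if "j \<in> {1..N}" for j
    using le[OF that] \<open>\<tau> > 0\<close> by (simp add: unnormalized_weight_def divide_right_mono)
  have RN: "RN_deriv (empirical_measure M x N) (empirical_conditional M gu gv \<theta> \<tau> x N v) (x j) =
      ennreal (real N * (unnormalized_weight gu gv \<theta> \<tau> (x j) v /
        (\<Sum>l=1..N. unnormalized_weight gu gv \<theta> \<tau> (x l) v)))" if "j \<in> {1..N}" for j
    using N sp sing that by (rule RN_deriv_empirical_conditional)
  have "RN_deriv (empirical_measure M x N) (empirical_conditional M gu gv \<theta> \<tau> x N v) (x j)
      \<le> RN_deriv (empirical_measure M x N) (empirical_conditional M gu gv \<theta> \<tau> x N v) (x i)"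
    if "j \<in> {1..N}" for j
    unfolding RN[OF that] RN[OF i]
    using weight_le[OF that] sum_unnormalized_weight_pos[OF N, of gu gv \<theta> \<tau> x v]
    by (intro ennreal_leI mult_left_mono divide_right_mono) auto
  \<comment> \<open>Every competitor in the image is some \<open>x j\<close>, so the comparison over
    indices suffices.\<close>
  then show ?thesis
    using i unfolding is_mode_def is_arg_max_linorder by blast
qed

theorem theorem4p2:
  fixes M :: "'u measure" and V :: "'v set"
    and gu :: "'u \<Rightarrow> 'p \<Rightarrow> real ^ 'n" and gv :: "'v \<Rightarrow> 'q \<Rightarrow> real ^ 'n"
    and \<theta> :: "'p \<times> 'q" and \<tau> :: real
    and x :: "nat \<Rightarrow> 'u" and N :: nat
  assumes "N \<ge> 1"
    and "\<And>i. i \<in> {1..N} \<Longrightarrow> x i \<in> space M"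
    and "\<And>i. i \<in> {1..N} \<Longrightarrow> {x i} \<in> sets M"
    and "\<tau> > 0"
    and "\<And>u. u \<in> space M \<Longrightarrow> gu u (fst \<theta>) \<in> sphere 0 1"
    and "\<And>v. v \<in> V \<Longrightarrow> gv v (snd \<theta>) \<in> sphere 0 1"
  shows "\<forall>v\<in>V.
    (\<exists>I. crossmodal_retrieval gu gv \<theta> x N v 1 I) \<and>
    (\<forall>I. crossmodal_retrieval gu gv \<theta> x N v 1 I \<longleftrightarrow>
       (\<exists>i. I = {i} \<and> is_arg_max (\<lambda>i. similarity gu gv \<theta> (x i) v) (\<lambda>i. i \<in> {1..N}) i)) \<and>
    (\<forall>i. is_arg_max (\<lambda>i. similarity gu gv \<theta> (x i) v) (\<lambda>i. i \<in> {1..N}) i \<longrightarrow>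
       is_mode (empirical_measure M x N) (empirical_conditional M gu gv \<theta> \<tau> x N v)
         (x ` {1..N}) (x i))"
proof (intro ballI conjI allI impI)
  fix v
  show "\<exists>I. crossmodal_retrieval gu gv \<theta> x N v 1 I"
    by (rule crossmodal_retrieval_1_exists[OF assms(1)])
  show "crossmodal_retrieval gu gv \<theta> x N v 1 I \<longleftrightarrow>
      (\<exists>i. I = {i} \<and> is_arg_max (\<lambda>i. similarity gu gv \<theta> (x i) v) (\<lambda>i. i \<in> {1..N}) i)" for I
    by (rule crossmodal_retrieval_1_iff)
  show "is_mode (empirical_measure M x N) (empirical_conditional M gu gv \<theta> \<tau> x N v)
      (x ` {1..N}) (x i)"
    if "is_arg_max (\<lambda>i. similarity gu gv \<theta> (x i) v) (\<lambda>i. i \<in> {1..N}) i" for i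
    by (rule is_arg_max_similarity_imp_is_mode[OF assms(1-4) that])
qed

end
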